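(* Let $(X,\|\cdot\|)$ be a non-trivial normed vector space, let $x\in X$ with $\|x\|=1=:a$, and let $\lambda\in(0,1)$. For every integer $n\ge 1$ define $x_n:=x$, $y_{2n}:=0$, $y_{2n-1}:=x$ and $t_n:=\lambda$. Then $\limsup_{n\to\infty}\|x_n\|=1$, $\limsup_{n\to\infty}\|y_n\|=1$, $t_nx_n+(1-t_n)y_n=\lambda x$ for even $n$, $t_nx_n+(1-t_n)y_n=x$ for odd $n$, and so $$\limsup_{n\to\infty}\|t_nx_n+(1-t_n)y_n\|=1.$$ Moreover, $\lim_{n\to\infty}\|x_n-y_n\|$ does not exist, and so it is different from $0$ (that is, $\|x_n-y_n\|$ does not converge to $0$).
   Context: "Non-trivial" means $X\neq\{0\}$. The sequences $(x_n)$, $(y_n)$ in $X$ and $(t_n)$ in $(0,1)$ are indexed by the positive integers. *)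

theory Defs
  imports "HOL-Analysis.Analysis"
begin

end

theory Submission
  imports Defs
begin

text \<open>
  From index 1 on the three norms in question take one value along the even indices and one along
  the odd indices: \<open>1, 1\<close> for \<open>x\<^sub>n\<close>, \<open>0, 1\<close> for \<open>y\<^sub>n\<close>, and \<open>\<lambda>, 1\<close> for the convex combinations.
  Both parities recur forever, so each limit superior is the larger of the two values, which is
  \<open>1\<close> every time because \<open>\<lambda> < 1\<close> (\<open>Limsup_eq_frequent_bound\<close>). The distances
  \<open>\<parallel>x\<^sub>n - y\<^sub>n\<parallel>\<close> alternate between \<open>1\<close> and \<open>0\<close>, and a limit has to agree with every value that
  recurs forever (\<open>tendsto_frequently_eq\<close>), so there is none.
\<close>

text \<open>A frequently attained value is attained on every set of the filter, so each of the suprema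
  whose infimum is the limit superior is at least that value.\<close>
lemma Limsup_eq_frequent_bound:
  fixes f :: "'i \<Rightarrow> 'b :: complete_lattice"
  assumes le: "eventually (\<lambda>n. f n \<le> c) F" and eq: "frequently (\<lambda>n. f n = c) F"
  shows "Limsup F f = c"
proof (rule antisym)
  show "Limsup F f \<le> c"
    by (rule Limsup_bounded [OF le])
  show "c \<le> Limsup F f"
    unfolding Limsup_def
  proof (rule INF_greatest)
    fix P assume "P \<in> {P. eventually P F}"
    then have "frequently (\<lambda>n. P n \<and> f n = c) F"
      using frequently_eventually_conj[OF eq, of P] by simp
    then obtain n where "P n" "f n = c"
      using frequently_ex by blast
    then show "c \<le> (SUP n\<in>Collect P. f n)"
      by (auto intro: SUP_upper)
  qed
qed

text \<open>Otherwise the complement of the recurring value would be a neighbourhood of the limit that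
  the function keeps leaving.\<close>
lemma tendsto_frequently_eq:
  fixes f :: "'i \<Rightarrow> 'b :: t1_space"
  assumes lim: "(f \<longlongrightarrow> l) F" and eq: "frequently (\<lambda>n. f n = a) F"
  shows "l = a"
proof (rule ccontr)
  assume "l \<noteq> a"
  then have "eventually (\<lambda>n. f n \<noteq> a) F"
    by (rule tendsto_imp_eventually_ne [OF lim])
  with eq show False
    by (simp add: frequently_def)
qed

lemma frequently_even: "frequently (\<lambda>n::nat. 1 \<le> n \<and> even n) sequentially"
  unfolding frequently_sequentially
proof
  fix N :: nat
  show "\<exists>n\<ge>N. 1 \<le> n \<and> even n"
    by (rule exI[of _ "2 * Suc N"]) simp
qed

lemma frequently_odd: "frequently (\<lambda>n::nat. 1 \<le> n \<and> odd n) sequentially"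
  unfolding frequently_sequentially
proof
  fix N :: nat
  show "\<exists>n\<ge>N. 1 \<le> n \<and> odd n"
    by (rule exI[of _ "2 * N + 1"]) simp
qed

theorem mainTheorem1:
  fixes x :: "'a :: real_normed_vector"
    and lam :: real
    and xs ys :: "nat \<Rightarrow> 'a"
    and t :: "nat \<Rightarrow> real"
  assumes nontrivial: "(UNIV :: 'a set) \<noteq> {0}"
    and norm_x: "norm x = 1"
    and lam: "lam \<in> {0<..<1}"
    and xs: "\<And>n. n \<ge> 1 \<Longrightarrow> xs n = x"
    and ys_even: "\<And>n. n \<ge> 1 \<Longrightarrow> ys (2 * n) = 0"
    and ys_odd: "\<And>n. n \<ge> 1 \<Longrightarrow> ys (2 * n - 1) = x"
    and t: "\<And>n. n \<ge> 1 \<Longrightarrow> t n = lam"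
  shows "limsup (\<lambda>n. ereal (norm (xs n))) = 1
    \<and> limsup (\<lambda>n. ereal (norm (ys n))) = 1
    \<and> (\<forall>n\<ge>1. even n \<longrightarrow> t n *\<^sub>R xs n + (1 - t n) *\<^sub>R ys n = lam *\<^sub>R x)
    \<and> (\<forall>n\<ge>1. odd n \<longrightarrow> t n *\<^sub>R xs n + (1 - t n) *\<^sub>R ys n = x)
    \<and> limsup (\<lambda>n. ereal (norm (t n *\<^sub>R xs n + (1 - t n) *\<^sub>R ys n))) = 1
    \<and> \<not> convergent (\<lambda>n. norm (xs n - ys n))
    \<and> \<not> (\<lambda>n. norm (xs n - ys n)) \<longlonglongrightarrow> 0"
proof -
  have y_even: "ys n = 0" if n: "1 \<le> n \<and> even n" for n
  proof -
    obtain k where "n = 2 * k" using n by (auto elim: evenE)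
    with n ys_even[of k] show ?thesis by simp
  qed
  have y_odd: "ys n = x" if n: "1 \<le> n \<and> odd n" for n
  proof -
    obtain k where "n = 2 * k + 1" using n by (auto elim: oddE)
    with ys_odd[of "k + 1"] show ?thesis by simp
  qed
  have comb_even: "t n *\<^sub>R xs n + (1 - t n) *\<^sub>R ys n = lam *\<^sub>R x" if n: "1 \<le> n \<and> even n" for n
    using n by (simp add: y_even xs t)
  have comb_odd: "t n *\<^sub>R xs n + (1 - t n) *\<^sub>R ys n = x" if n: "1 \<le> n \<and> odd n" for n
    using n by (simp add: y_odd xs t flip: scaleR_add_left)
  have limsup_one: "limsup (\<lambda>n. ereal (norm (z n))) = 1"
    if even: "\<And>n. 1 \<le> n \<and> even n \<Longrightarrow> norm (z n) \<le> 1"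
      and odd: "\<And>n. 1 \<le> n \<and> odd n \<Longrightarrow> norm (z n) = 1" for z :: "nat \<Rightarrow> 'a"
  proof (rule Limsup_eq_frequent_bound)
    have "norm (z n) \<le> 1" if "1 \<le> n" for n
      using that even[of n] odd[of n] by (cases "even n") auto
    then show "eventually (\<lambda>n. ereal (norm (z n)) \<le> 1) sequentially"
      by (intro eventually_sequentiallyI[of 1]) simp
    show "frequently (\<lambda>n. ereal (norm (z n)) = 1) sequentially"
      by (rule frequently_mono[OF _ frequently_odd]) (use odd in simp)
  qed
  have "limsup (\<lambda>n. ereal (norm (xs n))) = 1"
    by (rule limsup_one) (simp_all add: xs norm_x)
  moreover have "limsup (\<lambda>n. ereal (norm (ys n))) = 1"
    by (rule limsup_one) (simp_all add: y_even y_odd norm_x)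
  moreover have "limsup (\<lambda>n. ereal (norm (t n *\<^sub>R xs n + (1 - t n) *\<^sub>R ys n))) = 1"
    by (rule limsup_one) (use lam in \<open>simp_all add: comb_even comb_odd norm_x\<close>)
  moreover have "\<not> convergent (\<lambda>n. norm (xs n - ys n))"
  proof
    assume "convergent (\<lambda>n. norm (xs n - ys n))"
    then obtain l where l: "(\<lambda>n. norm (xs n - ys n)) \<longlonglongrightarrow> l"
      by (auto simp: convergent_def)
    have "frequently (\<lambda>n. norm (xs n - ys n) = 1) sequentially"
      by (rule frequently_mono[OF _ frequently_even]) (simp add: xs y_even norm_x)
    then have "l = 1"
      by (rule tendsto_frequently_eq[OF l])
    moreover have "frequently (\<lambda>n. norm (xs n - ys n) = 0) sequentially"
      by (rule frequently_mono[OF _ frequently_odd]) (simp add: xs y_odd)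
    then have "l = 0"
      by (rule tendsto_frequently_eq[OF l])
    ultimately show False by simp
  qed
  moreover from this have "\<not> (\<lambda>n. norm (xs n - ys n)) \<longlonglongrightarrow> 0"
    by (auto simp: convergent_def)
  ultimately show ?thesis
    using comb_even comb_odd by blast
qed

end
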